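(* Let $f:\mathbb{R}^n\to\mathbb{R}$ be continuously differentiable (no convexity is assumed), and let $\zeta>0$, $\delta\in(0,1)$, $\sigma\in(\delta,1)$, $m>0$, $M>0$ and $x_0\in\mathbb{R}^n$. Assume that: (1) the level set $\mathcal{A}_0=\{x\in\mathbb{R}^n : f(x)\le f(x_0)\}$ is bounded; (2) there are a neighborhood $\mathcal{S}$ of $\mathcal{A}_0$ (containing $\mathcal{A}_0$) and a constant $L>0$ such that $\|\nabla f(x)-\nabla f(\breve{x})\|\le L\|x-\breve{x}\|$ for all $x,\breve{x}\in\mathcal{S}$. Let $(x_k)_{k\ge0}$ be an infinite sequence of iterates generated by Algorithm MSTTMHS (defined in the context) applied to $f$ with these parameters and starting point, and let $g_k=\nabla f(x_k)$. Then $$\liminf_{k\to\infty}\|g_k\|=0 .$$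
   Context: $\|\cdot\|$ is the Euclidean norm. Algorithm MSTTMHS (modified spectral three-term extension of the modified Hestenes--Stiefel method) for minimizing a continuously differentiable $f:\mathbb{R}^n\to\mathbb{R}$. Parameters: $x_0\in\mathbb{R}^n$, $\zeta>0$, $\delta\in(0,1)$, $\sigma\in(\delta,1)$, and a lower bound $m>0$ and an upper bound $M>0$ for the spectral parameter. Write $g_k=\nabla f(x_k)$. Set $d_0=-g_0$. For $k=0,1,2,\dots$, as long as $g_k\neq 0$: 1. Choose a step length $\alpha_k>0$ satisfying the Wolfe conditions $$f(x_k+\alpha_kd_k)-f(x_k)\le\delta\,\alpha_k\,g_k^Td_k,\qquad \nabla f(x_k+\alpha_kd_k)^Td_k\ge\sigma\,g_k^Td_k .$$ 2. Set $s_k=\alpha_kd_k$, $x_{k+1}=x_k+s_k$, $y_k=g_{k+1}-g_k$ and $$z_k=y_k+\zeta\frac{\|y_k\|}{\|s_k\|}s_k,\qquad\text{so that } s_k^Tz_k=s_k^Ty_k+\zeta\|y_k\|\|s_k\| .$$ 3. If $g_{k+1}\ne0$, compute $$\eta_k^*=1-2\frac{(g_{k+1}^Ty_k)(g_{k+1}^Ts_k)}{\|g_{k+1}\|^2(s_k^Tz_k)}+\left(1+\frac{\|y_k\|^2}{s_k^Tz_k}\right)\frac{(g_{k+1}^Ts_k)^2}{\|g_{k+1}\|^2(s_k^Tz_k)},\qquad \bar\eta_k=\max\{m,\min\{M,\eta_k^*\}\},$$ and the next search direction $$d_{k+1}=-\bar\eta_k\,g_{k+1}+\frac{g_{k+1}^Ty_k}{s_k^Tz_k}\,s_k-\frac{g_{k+1}^Ts_k}{s_k^Tz_k}\,y_k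 .$$ The run stops at the first $k$ with $g_k=0$, if any; an infinite sequence of iterates thus means that $g_k\ne0$ for all $k$ and that step lengths satisfying the Wolfe conditions were chosen at every iteration. *)

theory Defs
  imports "HOL-Analysis.Analysis"
begin

text \<open>
  Throughout, \<open>gf\<close> stands for the gradient of the objective function \<open>f\<close>; \<open>s\<close>, \<open>y\<close> and
  \<open>g\<close> stand for \<open>s_k\<close>, \<open>y_k\<close> and \<open>g_{k+1}\<close>.
\<close>

definition wolfe :: "(real ^ 'n \<Rightarrow> real) \<Rightarrow> (real ^ 'n \<Rightarrow> real ^ 'n) \<Rightarrow> real \<Rightarrow> real \<Rightarrow>
    real ^ 'n \<Rightarrow> real ^ 'n \<Rightarrow> real \<Rightarrow> bool" where
  "wolfe f gf \<delta> \<sigma> x d \<alpha> \<longleftrightarrow>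
     f (x + \<alpha> *\<^sub>R d) - f x \<le> \<delta> * \<alpha> * (gf x \<bullet> d) \<and>
     gf (x + \<alpha> *\<^sub>R d) \<bullet> d \<ge> \<sigma> * (gf x \<bullet> d)"

definition zvec :: "real \<Rightarrow> real ^ 'n \<Rightarrow> real ^ 'n \<Rightarrow> real ^ 'n" where
  "zvec \<zeta> s y = y + (\<zeta> * (norm y / norm s)) *\<^sub>R s"

definition eta_star :: "real \<Rightarrow> real ^ 'n \<Rightarrow> real ^ 'n \<Rightarrow> real ^ 'n \<Rightarrow> real" where
  "eta_star \<zeta> s y g = (let sz = s \<bullet> zvec \<zeta> s y in
     1 - 2 * (((g \<bullet> y) * (g \<bullet> s)) / ((norm g)\<^sup>2 * sz))
       + (1 + (norm y)\<^sup>2 / sz) * ((g \<bullet> s)\<^sup>2 / ((norm g)\<^sup>2 * sz)))"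

text \<open>As in the algorithm, \<open>m \<le> M\<close> is not required; for \<open>m > M\<close> the value is \<open>m\<close>.\<close>

definition eta_bar :: "real \<Rightarrow> real \<Rightarrow> real \<Rightarrow> real ^ 'n \<Rightarrow> real ^ 'n \<Rightarrow> real ^ 'n \<Rightarrow> real" where
  "eta_bar \<zeta> m M s y g = max m (min M (eta_star \<zeta> s y g))"

definition next_dir :: "real \<Rightarrow> real \<Rightarrow> real \<Rightarrow> real ^ 'n \<Rightarrow> real ^ 'n \<Rightarrow> real ^ 'n \<Rightarrow> real ^ 'n" where
  "next_dir \<zeta> m M s y g = (let sz = s \<bullet> zvec \<zeta> s y in
     - (eta_bar \<zeta> m M s y g *\<^sub>R g) + ((g \<bullet> y) / sz) *\<^sub>R s - ((g \<bullet> s) / sz) *\<^sub>R y)"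

text \<open>
  An infinite run: iterates \<open>x\<close>, directions \<open>d\<close> and step lengths \<open>\<alpha>\<close>. The condition
  \<open>gf (x k) \<noteq> 0\<close> for all \<open>k\<close> expresses that the stopping test never succeeds. The step lengths
  are not a function of the other data: any choice satisfying the Wolfe conditions is a run.
\<close>

definition msttmhs_run :: "(real ^ 'n \<Rightarrow> real) \<Rightarrow> (real ^ 'n \<Rightarrow> real ^ 'n) \<Rightarrow>
    real \<Rightarrow> real \<Rightarrow> real \<Rightarrow> real \<Rightarrow> real \<Rightarrow> real ^ 'n \<Rightarrow>
    (nat \<Rightarrow> real ^ 'n) \<Rightarrow> (nat \<Rightarrow> real ^ 'n) \<Rightarrow> (nat \<Rightarrow> real) \<Rightarrow> bool" where
  "msttmhs_run f gf \<zeta> \<delta> \<sigma> m M x0 x d \<alpha> \<longleftrightarrow>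
     x 0 = x0 \<and> d 0 = - gf (x 0) \<and>
     (\<forall>k. gf (x k) \<noteq> 0 \<and>
          \<alpha> k > 0 \<and> wolfe f gf \<delta> \<sigma> (x k) (d k) (\<alpha> k) \<and>
          x (Suc k) = x k + \<alpha> k *\<^sub>R d k \<and>
          d (Suc k) = next_dir \<zeta> m M (\<alpha> k *\<^sub>R d k) (gf (x (Suc k)) - gf (x k)) (gf (x (Suc k))))"

end

theory Submission
  imports Defs
begin

text \<open>
  The two correction terms of the search direction cancel against the gradient, so
  \<open>g_k \<bullet> d_k = - \<eta> |g_k|\<^sup>2\<close> with \<open>\<eta>\<close> bounded away from \<open>0\<close>. The term \<open>\<zeta> |y_k| |s_k|\<close> in \<open>s_k \<bullet> z_k\<close>
  dominates the numerators of both corrections up to the factor \<open>1 / \<zeta>\<close>, so \<open>|d_k|\<close> is at most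
  a constant multiple of \<open>|g_k|\<close>. Hence the terms \<open>(g_k \<bullet> d_k)\<^sup>2 / |d_k|\<^sup>2\<close> of Zoutendijk's summable
  series dominate a multiple of \<open>|g_k|\<^sup>2\<close>, and in fact \<open>g_k \<rightarrow> 0\<close>.
\<close>

lemma inner_zvec: "s \<bullet> zvec \<zeta> s y = s \<bullet> y + \<zeta> * (norm y * norm s)"
  by (cases "s = 0") (auto simp: zvec_def inner_add_right power2_norm_eq_inner[symmetric] power2_eq_square)

text \<open>Paired with \<open>g\<close>, both corrections give
  \<open>(g \<bullet> y) * (g \<bullet> s) / sz\<close>, with opposite signs; what survives is the
  spectral term alone.\<close>

lemma inner_next_dir: "g \<bullet> next_dir \<zeta> m M s y g = - eta_bar \<zeta> m M s y g * (norm g)\<^sup>2"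
  by (simp add: next_dir_def Let_def inner_add_right inner_diff_right power2_norm_eq_inner)

text \<open>The upper bound is \<open>max m M\<close> rather than \<open>M\<close> because for
  \<open>m > M\<close> the outer maximum returns \<open>m\<close>.\<close>

lemma eta_bar_bounds: "m \<le> eta_bar \<zeta> m M s y g" "eta_bar \<zeta> m M s y g \<le> max m M"
  by (auto simp: eta_bar_def)

text \<open>By Cauchy-Schwarz each correction has norm at most \<open>norm g * p / sz\<close>, and
  \<open>s \<bullet> y \<ge> 0\<close> gives \<open>sz \<ge> \<zeta> * p\<close>. Hence each
  contributes at most \<open>norm g / \<zeta>\<close>, on top of the clipped spectral term.\<close>

lemma norm_next_dir_le:
  assumes "\<zeta> > 0" "m > 0" "s \<bullet> y \<ge> 0"
  shows "norm (next_dir \<zeta> m M s y g) \<le> (max m M + 2 / \<zeta>) * norm g"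
proof -
  define sz where "sz = s \<bullet> zvec \<zeta> s y"
  define p where "p = norm y * norm s"
  have p: "p \<ge> 0" by (simp add: p_def)
  have sz: "sz \<ge> \<zeta> * p" using assms by (simp add: sz_def inner_zvec p_def)
  then have sz0: "sz \<ge> 0" using p assms(1) by (meson mult_nonneg_nonneg order_trans less_imp_le)
  have q: "p / sz \<le> 1 / \<zeta>"
  \<comment> \<open>If \<open>sz = 0\<close>, the quotient is \<open>0\<close> by convention, and
    the bound only says \<open>0 \<le> 1 / \<zeta>\<close>.\<close>
  proof (cases "sz = 0")
    case False
    then show ?thesis using sz sz0 assms(1) by (simp add: field_simps)
  qed (use assms(1) in simp)
  have pq: "norm g * p / sz \<le> norm g / \<zeta>"
    using mult_left_mono[OF q, of "norm g"] by simp
  have "norm (((g \<bullet> y) / sz) *\<^sub>R s) = \<bar>g \<bullet> y\<bar> * norm s / sz"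
    using sz0 by simp
  also have "\<dots> \<le> norm g * norm y * norm s / sz"
    using sz0 by (intro divide_right_mono mult_right_mono Cauchy_Schwarz_ineq2) auto
  also have "\<dots> \<le> norm g / \<zeta>" using pq by (simp add: p_def mult.assoc)
  finally have A: "norm (((g \<bullet> y) / sz) *\<^sub>R s) \<le> norm g / \<zeta>" .
  have "norm (((g \<bullet> s) / sz) *\<^sub>R y) = \<bar>g \<bullet> s\<bar> * norm y / sz"
    using sz0 by simp
  also have "\<dots> \<le> norm g * norm s * norm y / sz"
    using sz0 by (intro divide_right_mono mult_right_mono Cauchy_Schwarz_ineq2) auto
  also have "\<dots> \<le> norm g / \<zeta>" using pq by (simp add: p_def mult_ac)
  finally have B: "norm (((g \<bullet> s) / sz) *\<^sub>R y) \<le> norm g / \<zeta>" .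
  have "\<bar>eta_bar \<zeta> m M s y g\<bar> \<le> max m M"
    using eta_bar_bounds[where m = m and M = M and \<zeta> = \<zeta> and s = s and y = y and g = g] assms(2)
    by linarith
  then have C: "norm (- (eta_bar \<zeta> m M s y g *\<^sub>R g)) \<le> max m M * norm g"
    by (simp add: mult_right_mono)
  have "norm (next_dir \<zeta> m M s y g) \<le> max m M * norm g + norm g / \<zeta> + norm g / \<zeta>"
    unfolding next_dir_def Let_def sz_def[symmetric]
    by (rule norm_triangle_le_diff, rule add_mono[OF norm_triangle_le B], rule add_mono[OF C A])
  then show ?thesis by (simp add: algebra_simps)
qed

text \<open>The curvature condition and the Lipschitz estimate together keep the step length from
  being too small; inserting this lower bound for \<open>\<alpha>\<close> into the sufficient
  decrease condition yields one term of Zoutendijk's series.\<close>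

lemma wolfe_decrease:
  assumes wolfe: "wolfe f gf \<delta> \<sigma> x d \<alpha>"
    and "\<alpha> \<ge> 0" "\<delta> \<ge> 0" "\<sigma> \<le> 1" "L > 0" and descent: "gf x \<bullet> d \<le> 0"
    and lip: "norm (gf (x + \<alpha> *\<^sub>R d) - gf x) \<le> L * norm (\<alpha> *\<^sub>R d)"
  shows "\<delta> * (1 - \<sigma>) / L * ((gf x \<bullet> d)\<^sup>2 / (norm d)\<^sup>2) \<le> f x - f (x + \<alpha> *\<^sub>R d)"
proof -
  define t where "t = - (gf x \<bullet> d)"
  have t: "t \<ge> 0" using descent by (simp add: t_def)
  have dec: "\<delta> * \<alpha> * t \<le> f x - f (x + \<alpha> *\<^sub>R d)"
    using wolfe by (simp add: wolfe_def t_def)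
  \<comment> \<open>This is the curvature condition with \<open>gf x \<bullet> d\<close> subtracted
    from both sides.\<close>
  have "(1 - \<sigma>) * t \<le> (gf (x + \<alpha> *\<^sub>R d) - gf x) \<bullet> d"
    using wolfe by (simp add: wolfe_def t_def inner_diff_left algebra_simps)
  also have "\<dots> \<le> norm (gf (x + \<alpha> *\<^sub>R d) - gf x) * norm d"
    by (rule norm_cauchy_schwarz)
  also have "\<dots> \<le> L * norm (\<alpha> *\<^sub>R d) * norm d"
    by (rule mult_right_mono[OF lip]) simp
  also have "\<dots> = L * \<alpha> * (norm d)\<^sup>2"
    using \<open>\<alpha> \<ge> 0\<close> by (simp add: power2_eq_square)
  finally have curv: "(1 - \<sigma>) * t \<le> L * \<alpha> * (norm d)\<^sup>2" .
  have step: "(1 - \<sigma>) / L * (t / (norm d)\<^sup>2) \<le> \<alpha>"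
  proof (cases "d = 0")
    case False
    then show ?thesis using curv \<open>L > 0\<close> by (simp add: field_simps)
  qed (use \<open>\<alpha> \<ge> 0\<close> in simp)
  have "\<delta> * (1 - \<sigma>) / L * (t\<^sup>2 / (norm d)\<^sup>2) = \<delta> * ((1 - \<sigma>) / L * (t / (norm d)\<^sup>2)) * t"
    by (simp add: power2_eq_square)
  also have "\<dots> \<le> \<delta> * \<alpha> * t"
    using step t \<open>\<delta> \<ge> 0\<close> by (intro mult_right_mono mult_left_mono)
  finally show ?thesis using dec by (simp add: t_def)
qed

text \<open>Up to the factor \<open>c\<close> each term is at most the decrease of \<open>f\<close>
  in that step. The decreases telescope, so the partial sums of nonnegative terms stay below
  \<open>f (x 0) - b\<close>.\<close>

lemma zoutendijk:
  fixes x d :: "nat \<Rightarrow> real ^ 'n"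
  assumes "0 < \<delta>" "\<sigma> < 1" "L > 0"
    and "\<And>k. wolfe f gf \<delta> \<sigma> (x k) (d k) (\<alpha> k)" "\<And>k. \<alpha> k \<ge> 0"
    and step: "\<And>k. x (Suc k) = x k + \<alpha> k *\<^sub>R d k"
    and "\<And>k. gf (x k) \<bullet> d k \<le> 0"
    and "\<And>k. norm (gf (x (Suc k)) - gf (x k)) \<le> L * norm (x (Suc k) - x k)"
    and below: "\<And>k. b \<le> f (x k)"
  shows "summable (\<lambda>k. (gf (x k) \<bullet> d k)\<^sup>2 / (norm (d k))\<^sup>2)"
proof -
  define c where "c = \<delta> * (1 - \<sigma>) / L"
  have c: "c > 0" using assms by (simp add: c_def)
  have dec: "c * ((gf (x k) \<bullet> d k)\<^sup>2 / (norm (d k))\<^sup>2) \<le> f (x k) - f (x (Suc k))" for k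
    unfolding c_def step using assms(1-7) assms(8)[of k]
    by (intro wolfe_decrease) (auto simp: less_imp_le)
  have "summable (\<lambda>k. c * ((gf (x k) \<bullet> d k)\<^sup>2 / (norm (d k))\<^sup>2))"
  proof (rule summableI_nonneg_bounded)
    fix n
    have "(\<Sum>k<n. c * ((gf (x k) \<bullet> d k)\<^sup>2 / (norm (d k))\<^sup>2)) \<le> (\<Sum>k<n. f (x k) - f (x (Suc k)))"
      by (intro sum_mono dec)
    also have "\<dots> = f (x 0) - f (x n)" by (rule sum_lessThan_telescope')
    also have "\<dots> \<le> f (x 0) - b" using below by simp
    finally show "(\<Sum>k<n. c * ((gf (x k) \<bullet> d k)\<^sup>2 / (norm (d k))\<^sup>2)) \<le> f (x 0) - b" .
  qed (use c in simp)
  then show ?thesis by (rule summable_mult_D) (use c in simp)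
qed

theorem theorem3p4:
  fixes f :: "real ^ 'n \<Rightarrow> real" and gf :: "real ^ 'n \<Rightarrow> real ^ 'n"
    and \<zeta> \<delta> \<sigma> m M L :: real and x0 :: "real ^ 'n" and S :: "(real ^ 'n) set"
    and x d :: "nat \<Rightarrow> real ^ 'n" and \<alpha> :: "nat \<Rightarrow> real"
  assumes gradient: "\<And>u. GDERIV f u :> gf u"
    and gradient_continuous: "continuous_on UNIV gf"
    and "\<zeta> > 0" and "0 < \<delta>" and "\<delta> < 1" and "\<delta> < \<sigma>" and "\<sigma> < 1" and "m > 0" and "M > 0"
    and level_bounded: "bounded {u. f u \<le> f x0}"
    and neighborhood: "{u. f u \<le> f x0} \<subseteq> interior S"
    and "L > 0"
    and lipschitz: "\<And>u v. u \<in> S \<Longrightarrow> v \<in> S \<Longrightarrow> norm (gf u - gf v) \<le> L * norm (u - v)"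
    and run: "msttmhs_run f gf \<zeta> \<delta> \<sigma> m M x0 x d \<alpha>"
  shows "liminf (\<lambda>k. ereal (norm (gf (x k)))) = 0"
proof -
  \<comment> \<open>\<open>C\<close> and \<open>c\<close> must serve all directions at once:
    \<open>max m M + 2 / \<zeta>\<close> and \<open>m\<close> come from the update formula, while
    the two occurrences of \<open>1\<close> account for the steepest descent start
    \<open>d 0 = - gf (x 0)\<close>.\<close>
  define C where "C = 1 + max m M + 2 / \<zeta>"
  define c where "c = min 1 m"
  have C: "C > 0" and c: "c > 0"
    using \<open>m > 0\<close> \<open>\<zeta> > 0\<close> by (auto simp: C_def c_def intro!: add_pos_pos)
  have x0: "x 0 = x0" and d0: "d 0 = - gf (x 0)" and nz: "gf (x k) \<noteq> 0"
    and \<alpha>: "\<alpha> k > 0" and wolfe: "wolfe f gf \<delta> \<sigma> (x k) (d k) (\<alpha> k)"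
    and step: "x (Suc k) = x k + \<alpha> k *\<^sub>R d k"
    and dir: "d (Suc k) = next_dir \<zeta> m M (\<alpha> k *\<^sub>R d k) (gf (x (Suc k)) - gf (x k)) (gf (x (Suc k)))" for k
    using run by (auto simp: msttmhs_run_def)
  have descent: "gf (x k) \<bullet> d k \<le> - c * (norm (gf (x k)))\<^sup>2" for k
  proof (cases k)
    case 0
    have "c * (norm (gf (x 0)))\<^sup>2 \<le> 1 * (norm (gf (x 0)))\<^sup>2"
      by (rule mult_right_mono) (simp_all add: c_def)
    then show ?thesis by (simp add: 0 d0 power2_norm_eq_inner)
  next
    case (Suc j)
    have "c \<le> eta_bar \<zeta> m M s y g" for s y g :: "real ^ 'n"
      using eta_bar_bounds(1)[where m = m and M = M and \<zeta> = \<zeta> and s = s and y = y and g = g]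
      by (simp add: c_def)
    then show ?thesis by (simp add: Suc dir inner_next_dir mult_right_mono)
  qed
  have neg: "gf (x k) \<bullet> d k < 0" for k
  proof -
    have "c * (norm (gf (x k)))\<^sup>2 > 0" using c nz by simp
    then show ?thesis using descent[of k] by linarith
  qed
  \<comment> \<open>The curvature condition makes \<open>s_k \<bullet> y_k\<close> nonnegative: the
    slope along \<open>d k\<close> grows by at least
    \<open>(\<sigma> - 1) * (gf (x k) \<bullet> d k)\<close>, which is positive for a descent
    direction.\<close>
  have "(\<alpha> k *\<^sub>R d k) \<bullet> (gf (x (Suc k)) - gf (x k)) \<ge> 0" for k
  proof -
    have "gf (x (Suc k)) \<bullet> d k \<ge> \<sigma> * (gf (x k) \<bullet> d k)"
      using wolfe[of k] by (simp add: wolfe_def step)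
    moreover have "(1 - \<sigma>) * (gf (x k) \<bullet> d k) \<le> 0"
      using neg[of k] \<open>\<sigma> < 1\<close> by (intro mult_nonneg_nonpos) auto
    ultimately have "0 \<le> d k \<bullet> (gf (x (Suc k)) - gf (x k))"
      by (simp add: inner_diff_right inner_commute algebra_simps)
    then show ?thesis using \<alpha>[of k] by simp
  qed
  then have norm_Suc: "norm (d (Suc k)) \<le> (max m M + 2 / \<zeta>) * norm (gf (x (Suc k)))" for k
    unfolding dir by (intro norm_next_dir_le) (use \<open>\<zeta> > 0\<close> \<open>m > 0\<close> in auto)
  have norm_d: "norm (d k) \<le> C * norm (gf (x k))" for k
  proof (cases k)
    case 0
    have "0 \<le> (max m M + 2 / \<zeta>) * norm (gf (x 0))"
      using \<open>m > 0\<close> \<open>\<zeta> > 0\<close> by (intro mult_nonneg_nonneg add_nonneg_nonneg) auto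
    then show ?thesis by (simp add: 0 d0 C_def algebra_simps)
  next
    case (Suc j)
    have "(max m M + 2 / \<zeta>) * norm (gf (x (Suc j))) \<le> C * norm (gf (x (Suc j)))"
      by (rule mult_right_mono) (simp_all add: C_def)
    then show ?thesis using norm_Suc[of j] Suc by simp
  qed
  have level: "f (x k) \<le> f x0" for k
  proof (induction k)
    case (Suc k)
    have "\<delta> * \<alpha> k * (gf (x k) \<bullet> d k) \<le> 0"
      using \<alpha>[of k] neg[of k] \<open>0 < \<delta>\<close> by (intro mult_nonneg_nonpos) auto
    then show ?case using wolfe[of k] Suc by (simp add: wolfe_def step)
  qed (simp add: x0)
  have cont: "continuous_on UNIV f"
    using gradient by (auto simp: gderiv_def intro!: has_derivative_continuous_on)
  have "compact {u. f u \<le> f x0}"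
    unfolding compact_eq_bounded_closed
    using level_bounded by (auto intro!: closed_Collect_le cont)
  \<comment> \<open>The minimizer \<open>v\<close> of \<open>f\<close> on the compact level set
    supplies the lower bound \<open>b = f v\<close> along the run, since all iterates stay in that
    set.\<close>
  then obtain v where v: "\<And>u. f u \<le> f x0 \<Longrightarrow> f v \<le> f u"
    using continuous_attains_inf[of "{u. f u \<le> f x0}" f] continuous_on_subset[OF cont] by auto
  have inS: "x k \<in> S" for k
    using level[of k] neighborhood interior_subset by blast
  have "summable (\<lambda>k. (gf (x k) \<bullet> d k)\<^sup>2 / (norm (d k))\<^sup>2)"
    using \<open>0 < \<delta>\<close> \<open>\<sigma> < 1\<close> \<open>L > 0\<close> wolfe less_imp_le[OF \<alpha>] step less_imp_le[OF neg]
      lipschitz[OF inS inS] v[OF level]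
    by (rule zoutendijk)
  then have lim: "(\<lambda>k. (C / c)\<^sup>2 * ((gf (x k) \<bullet> d k)\<^sup>2 / (norm (d k))\<^sup>2)) \<longlonglongrightarrow> 0"
    by (intro tendsto_mult_right_zero summable_LIMSEQ_zero)
  \<comment> \<open>Multiplying \<open>norm (d k) \<le> C * norm (gf (x k))\<close> by
    \<open>c * norm (gf (x k))\<close> and using the descent estimate gives \<open>c * norm (gf (x
    k)) * norm (d k) \<le> C * \<bar>gf (x k) \<bullet> d k\<bar>\<close>; dividing and squaring
    explains the factor \<open>(C / c)\<^sup>2\<close>.\<close>
  have bound: "(norm (gf (x k)))\<^sup>2 \<le> (C / c)\<^sup>2 * ((gf (x k) \<bullet> d k)\<^sup>2 / (norm (d k))\<^sup>2)" for k
  proof -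
    have d: "norm (d k) > 0" using neg[of k] by auto
    have "c * norm (gf (x k)) * norm (d k) \<le> c * norm (gf (x k)) * (C * norm (gf (x k)))"
      using c norm_d[of k] by (intro mult_left_mono) auto
    also have "\<dots> = C * (c * (norm (gf (x k)))\<^sup>2)" by (simp add: power2_eq_square)
    also have "\<dots> \<le> C * \<bar>gf (x k) \<bullet> d k\<bar>"
      using C descent[of k] by (intro mult_left_mono) auto
    finally have "norm (gf (x k)) \<le> C / c * (\<bar>gf (x k) \<bullet> d k\<bar> / norm (d k))"
      using c d by (simp add: field_simps)
    then have "(norm (gf (x k)))\<^sup>2 \<le> (C / c * (\<bar>gf (x k) \<bullet> d k\<bar> / norm (d k)))\<^sup>2"
      by (rule power_mono) simp
    then show ?thesis by (simp add: power_mult_distrib power_divide)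
  qed
  have "(\<lambda>k. (norm (gf (x k)))\<^sup>2) \<longlonglongrightarrow> 0"
    by (rule tendsto_sandwich[OF _ _ tendsto_const lim]) (use bound in auto)
  \<comment> \<open>Taking square roots turns convergence of the squares into convergence of the
    norms; the lower limit is then the limit itself.\<close>
  then have "(\<lambda>k. ereal (norm (gf (x k)))) \<longlonglongrightarrow> ereal 0"
    by (auto dest: tendsto_real_sqrt)
  then show ?thesis
    by (simp add: lim_imp_Liminf zero_ereal_def)
qed

end
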